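(* Let $X$ be a locally compact Hausdorff space. (a) Let $J$ be a norm-closed ideal in $C_0(X)$. If every net $(f_\alpha)$ in $J$ that is un-null in $J$ is also un-null in $C_0(X)$, then $J$ is a projection band in $C_0(X)$. (b) Let $x\in X$. If every net in $J_{\{x\}}^0(X)$ that is un-null in $J_{\{x\}}^0(X)$ is also un-null in $C_0(X)$, then $x$ is an isolated point of $X$. (c) If for every maximal ideal $J$ in $C_0(X)$, every net in $J$ that is un-null in $J$ is also un-null in $C_0(X)$, then $X$ is discrete.
   Context: $C_0(X)$ is the Banach lattice of continuous real-valued functions on $X$ vanishing at infinity, with the supremum norm and pointwise order. Ideal means order ideal: a linear subspace $Y$ of a vector lattice $E$ such that $0\le |x|\le |y|$ with $x\in E$, $y\in Y$ implies $x\in Y$ (for norm-closed subspaces of $C_0(X)$ order ideals and algebra ideals are the same); a maximal ideal is a maximal proper ideal. For $x\in X$, $J_{\{x\}}^0(X)=\{f\in C_0(X): f(x)=0\}$. In a Banach lattice $E$, a net $(x_\alpha)$ is un-null in $E$ if for every $y\in E_+$ one has $\bigl\||x_\alpha|\wedge y\bigr\|\to 0$. An ideal $J$ is regarded as a normed lattice itself, so a net $(f_\alpha)$ in $J$ is un-null in $J$ if $\bigl\||f_\alpha|\wedge g\bigr\|\to 0$ for every $g\in J_+$. A band $B$ in a vector lattice $E$ is an order ideal such that whenever $(x_\alpha)$ is a net in $B$ with $0\le x_\alpha\nearrow x$ in $E$ (increasing with supremum $x$ in $E$), then $x\in B$. With $B^d=\{x\in E: |x|\wedge |b|=0\text{ for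 all } b\in B\}$, a band $B$ is a projection band if $E=B\oplus B^d$. *)

theory Defs
  imports "HOL-Analysis.Analysis"
begin

section \<open>Nets\<close>

text \<open>
  A net is a family \<open>f\<close> indexed by a nonempty directed preordered set \<open>D\<close> with preorder \<open>le\<close>. Its
  convergence is convergence along the filter of tails, see \<open>tendsto_tails_iff\<close>.
\<close>

definition directed_on :: "'i set \<Rightarrow> ('i \<Rightarrow> 'i \<Rightarrow> bool) \<Rightarrow> bool" where
  "directed_on D le \<longleftrightarrow> D \<noteq> {} \<and> reflp_on D le \<and> transp_on D le \<and>
     (\<forall>a\<in>D. \<forall>b\<in>D. \<exists>c\<in>D. le a c \<and> le b c)"

definition tails :: "'i set \<Rightarrow> ('i \<Rightarrow> 'i \<Rightarrow> bool) \<Rightarrow> 'i filter" where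
  "tails D le = (INF d\<in>D. principal {a\<in>D. le d a})"

lemma eventually_tails:
  assumes "directed_on D le"
  shows "eventually P (tails D le) \<longleftrightarrow> (\<exists>d\<in>D. \<forall>a\<in>D. le d a \<longrightarrow> P a)"
proof -
  have "\<exists>c\<in>D. principal {x\<in>D. le c x} \<le> inf (principal {x\<in>D. le a x}) (principal {x\<in>D. le b x})"
    if ab: "a \<in> D" "b \<in> D" for a b
  proof -
    obtain c where c: "c \<in> D" "le a c" "le b c"
      using assms ab unfolding directed_on_def by blast
    have tr: "le u w" if "le u v" "le v w" "u \<in> D" "v \<in> D" "w \<in> D" for u v w
      using assms that unfolding directed_on_def transp_on_def by blast
    have "{x\<in>D. le c x} \<subseteq> {x\<in>D. le a x} \<inter> {x\<in>D. le b x}"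
      using tr[OF c(2) _ ab(1) c(1)] tr[OF c(3) _ ab(2) c(1)] by auto
    then show ?thesis
      using c(1) by (intro bexI[of _ c]) simp_all
  qed
  then show ?thesis
    using assms unfolding tails_def
    by (subst eventually_INF_base) (auto simp: eventually_principal directed_on_def)
qed

lemma tendsto_tails_iff:
  fixes r :: "'i \<Rightarrow> real"
  assumes "directed_on D le"
  shows "(r \<longlongrightarrow> l) (tails D le) \<longleftrightarrow>
    (\<forall>e>0. \<exists>d\<in>D. \<forall>a\<in>D. le d a \<longrightarrow> \<bar>r a - l\<bar> < e)"
  by (simp add: tendsto_iff eventually_tails[OF assms] dist_real_def)

text \<open>
  HOL cannot quantify over all index types inside a formula. In statements about all nets of
  functions \<open>'a \<Rightarrow> real\<close>, index sets are therefore taken to be arbitrary directed sets in the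
  following type. No nets are lost: see \<open>band_all_index_types\<close> and
  \<open>un_null_passes_all_index_types\<close>.
\<close>

type_synonym 'a index = "('a \<Rightarrow> real) set \<times> ('a \<Rightarrow> real)"


section \<open>The Banach lattice of continuous functions vanishing at infinity\<close>

text \<open>
  Functions on the space \<open>X\<close> are represented by total functions that are 0 off \<open>topspace X\<close>. So
  equality, the order, and the supremum over all points of the type are those on \<open>topspace X\<close>
  (and the supremum also makes sense if \<open>topspace X\<close> is empty).
\<close>

definition C0 :: "'a topology \<Rightarrow> ('a \<Rightarrow> real) set" where
  "C0 X = {f. continuous_map X euclideanreal f \<and>
              (\<forall>e>0. compactin X {x \<in> topspace X. e \<le> \<bar>f x\<bar>}) \<and>
              (\<forall>x. x \<notin> topspace X \<longrightarrow> f x = 0)}"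

definition supnorm :: "('a \<Rightarrow> real) \<Rightarrow> real" where
  "supnorm f = (SUP x. \<bar>f x\<bar>)"

lemma C0_bounded:
  assumes "f \<in> C0 X"
  shows "bdd_above (range (\<lambda>x. \<bar>f x\<bar>))"
proof -
  let ?K = "{x \<in> topspace X. 1 \<le> \<bar>f x\<bar>}"
  have "compactin euclideanreal (f ` ?K)"
    using assms by (intro image_compactin[of X]) (auto simp: C0_def)
  then have "bounded (f ` ?K)"
    by (simp add: compact_imp_bounded)
  then obtain B where B: "\<And>x. x \<in> ?K \<Longrightarrow> \<bar>f x\<bar> \<le> B"
    by (auto simp: bounded_iff)
  have "\<bar>f x\<bar> \<le> max B 1" for x
  proof (cases "x \<in> ?K")
    case True
    then show ?thesis using B[of x] by linarith
  next
    case False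
    then have "\<bar>f x\<bar> < 1" using assms by (cases "x \<in> topspace X") (auto simp: C0_def)
    then show ?thesis by linarith
  qed
  then show ?thesis by (intro bdd_aboveI2)
qed


section \<open>Ideals and bands\<close>

text \<open>
  In this section \<open>E\<close> is a vector lattice of real functions under the pointwise operations and
  order, such as \<open>C0 X\<close> or an ideal in it.
\<close>

definition order_ideal :: "('a \<Rightarrow> real) set \<Rightarrow> ('a \<Rightarrow> real) set \<Rightarrow> bool" where
  "order_ideal E Y \<longleftrightarrow> Y \<subseteq> E \<and>
     (\<lambda>t. 0) \<in> Y \<and>
     (\<forall>f\<in>Y. \<forall>g\<in>Y. (\<lambda>t. f t + g t) \<in> Y) \<and>
     (\<forall>c. \<forall>f\<in>Y. (\<lambda>t. c * f t) \<in> Y) \<and>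
     (\<forall>f\<in>E. \<forall>g\<in>Y. (\<forall>t. \<bar>f t\<bar> \<le> \<bar>g t\<bar>) \<longrightarrow> f \<in> Y)"

definition maximal_ideal :: "('a \<Rightarrow> real) set \<Rightarrow> ('a \<Rightarrow> real) set \<Rightarrow> bool" where
  "maximal_ideal E J \<longleftrightarrow> order_ideal E J \<and> J \<noteq> E \<and>
     (\<forall>I. order_ideal E I \<and> J \<subseteq> I \<longrightarrow> I = J \<or> I = E)"

definition norm_closed_in :: "('a \<Rightarrow> real) set \<Rightarrow> ('a \<Rightarrow> real) set \<Rightarrow> bool" where
  "norm_closed_in E Y \<longleftrightarrow> Y \<subseteq> E \<and>
     (\<forall>f\<in>E. (\<forall>e>0. \<exists>g\<in>Y. supnorm (\<lambda>t. f t - g t) < e) \<longrightarrow> f \<in> Y)"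

definition is_sup_in :: "('a \<Rightarrow> real) set \<Rightarrow> ('a \<Rightarrow> real) set \<Rightarrow> ('a \<Rightarrow> real) \<Rightarrow> bool" where
  "is_sup_in E S f \<longleftrightarrow> f \<in> E \<and> (\<forall>g\<in>S. g \<le> f) \<and> (\<forall>h\<in>E. (\<forall>g\<in>S. g \<le> h) \<longrightarrow> f \<le> h)"

definition band :: "('a \<Rightarrow> real) set \<Rightarrow> ('a \<Rightarrow> real) set \<Rightarrow> bool" where
  "band E B \<longleftrightarrow> order_ideal E B \<and>
     (\<forall>(D :: 'a index set) le u f.
        directed_on D le \<and> (\<forall>a\<in>D. u a \<in> B \<and> (\<lambda>t. 0) \<le> u a) \<and>
        (\<forall>a\<in>D. \<forall>b\<in>D. le a b \<longrightarrow> u a \<le> u b) \<and> is_sup_in E (u ` D) f \<longrightarrow> f \<in> B)"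

definition disjoint_complement :: "('a \<Rightarrow> real) set \<Rightarrow> ('a \<Rightarrow> real) set \<Rightarrow> ('a \<Rightarrow> real) set" where
  "disjoint_complement E B = {f\<in>E. \<forall>b\<in>B. \<forall>t. min \<bar>f t\<bar> \<bar>b t\<bar> = 0}"

definition projection_band :: "('a \<Rightarrow> real) set \<Rightarrow> ('a \<Rightarrow> real) set \<Rightarrow> bool" where
  "projection_band E B \<longleftrightarrow> band E B \<and>
     (\<forall>f\<in>E. \<exists>g\<in>B. \<exists>h\<in>disjoint_complement E B. f = (\<lambda>t. g t + h t)) \<and>
     B \<inter> disjoint_complement E B = {\<lambda>t. 0}"

definition vanishing_ideal :: "'a topology \<Rightarrow> 'a set \<Rightarrow> ('a \<Rightarrow> real) set" where
  "vanishing_ideal X S = {f \<in> C0 X. \<forall>x\<in>S. f x = 0}"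

lemma band_all_index_types:
  fixes D :: "'j set"
  assumes "band E B" and dir: "directed_on D le"
    and pos: "\<And>a. a \<in> D \<Longrightarrow> u a \<in> B \<and> (\<lambda>t. 0) \<le> u a"
    and mono: "\<And>a b. a \<in> D \<Longrightarrow> b \<in> D \<Longrightarrow> le a b \<Longrightarrow> u a \<le> u b"
    and sup: "is_sup_in E (u ` D) f"
  shows "f \<in> B"
proof -
  define D' :: "'a index set" where "D' = Pair {} ` u ` D"
  let ?le = "\<lambda>p q :: 'a index. snd p \<le> snd q"
  have "directed_on D' ?le"
    unfolding directed_on_def
  proof (intro conjI ballI)
    show "D' \<noteq> {}" using dir by (auto simp: D'_def directed_on_def)
    show "reflp_on D' ?le" by (auto intro: reflp_onI)
    show "transp_on D' ?le" by (auto intro!: transp_onI intro: order_trans)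
    fix p q assume "p \<in> D'" "q \<in> D'"
    then obtain a b where ab: "a \<in> D" "b \<in> D" "p = ({}, u a)" "q = ({}, u b)"
      by (auto simp: D'_def)
    then obtain c where "c \<in> D" "le a c" "le b c" using dir unfolding directed_on_def by blast
    then show "\<exists>r\<in>D'. ?le p r \<and> ?le q r"
      using ab mono by (intro bexI[of _ "({}, u c)"]) (auto simp: D'_def)
  qed
  moreover have "\<forall>p\<in>D'. snd p \<in> B \<and> (\<lambda>t. 0) \<le> snd p" using pos by (auto simp: D'_def)
  moreover have "snd ` D' = u ` D" by (force simp: D'_def)
  moreover have "\<forall>p\<in>D'. \<forall>q\<in>D'. ?le p q \<longrightarrow> snd p \<le> snd q" by simp
  ultimately have "directed_on D' ?le \<and> (\<forall>p\<in>D'. snd p \<in> B \<and> (\<lambda>t. 0) \<le> snd p) \<and>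
      (\<forall>p\<in>D'. \<forall>q\<in>D'. ?le p q \<longrightarrow> snd p \<le> snd q) \<and> is_sup_in E (snd ` D') f"
    using sup by simp
  with assms(1)[unfolded band_def, THEN conjunct2, rule_format, of D' ?le snd f]
  show ?thesis by blast
qed


section \<open>Un-null nets\<close>

definition un_null :: "('a \<Rightarrow> real) set \<Rightarrow> 'i set \<Rightarrow> ('i \<Rightarrow> 'i \<Rightarrow> bool) \<Rightarrow> ('i \<Rightarrow> 'a \<Rightarrow> real) \<Rightarrow> bool" where
  "un_null E D le f \<longleftrightarrow>
     (\<forall>g\<in>E. (\<lambda>t. 0) \<le> g \<longrightarrow> ((\<lambda>a. supnorm (\<lambda>t. min \<bar>f a t\<bar> (g t))) \<longlongrightarrow> 0) (tails D le))"

definition un_null_passes :: "('a \<Rightarrow> real) set \<Rightarrow> ('a \<Rightarrow> real) set \<Rightarrow> bool" where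
  "un_null_passes J E \<longleftrightarrow>
     (\<forall>(D :: 'a index set) le f.
        directed_on D le \<and> (\<forall>a\<in>D. f a \<in> J) \<and> un_null J D le f \<longrightarrow> un_null E D le f)"

lemma un_null_passes_all_index_types:
  fixes D :: "'j set"
  assumes passes: "un_null_passes J E" and dir: "directed_on D le"
    and J: "\<And>a. a \<in> D \<Longrightarrow> f a \<in> J" and null: "un_null J D le f"
  shows "un_null E D le f"
proof -
  define T where "T d = f ` {a\<in>D. le d a}" for d
  define D' :: "'a index set" where "D' = {(A, h). h \<in> A \<and> (\<exists>d\<in>D. A = T d)}"
  let ?le = "\<lambda>p q :: 'a index. fst q \<subseteq> fst p"
  have refl: "le d d" if "d \<in> D" for d
    using dir that by (auto simp: directed_on_def reflp_on_def)
  have trans: "le a c" if "le a b" "le b c" "a \<in> D" "b \<in> D" "c \<in> D" for a b c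
    using dir that unfolding directed_on_def transp_on_def by blast
  have inD': "(T d, f a) \<in> D'" if "d \<in> D" "a \<in> D" "le d a" for d a
    using that by (auto simp: D'_def T_def)
  have dir': "directed_on D' ?le"
    unfolding directed_on_def
  proof (intro conjI ballI)
    show "D' \<noteq> {}"
    proof -
      obtain d where "d \<in> D" using dir unfolding directed_on_def by blast
      then show ?thesis using inD' refl by blast
    qed
    show "reflp_on D' ?le" by (auto intro: reflp_onI)
    show "transp_on D' ?le" by (auto intro!: transp_onI)
    fix p q assume "p \<in> D'" "q \<in> D'"
    then obtain a b where ab: "a \<in> D" "b \<in> D" "fst p = T a" "fst q = T b"
      by (auto simp: D'_def)
    then obtain c where c: "c \<in> D" "le a c" "le b c" using dir unfolding directed_on_def by blast
    then have "T c \<subseteq> T a" "T c \<subseteq> T b" using ab trans unfolding T_def by blast+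
    then show "\<exists>r\<in>D'. ?le p r \<and> ?le q r"
      using ab c inD' refl by (intro bexI[of _ "(T c, f c)"]) auto
  qed
  have ev: "(\<exists>p\<in>D'. \<forall>q\<in>D'. ?le p q \<longrightarrow> P (snd q)) \<longleftrightarrow> (\<exists>d\<in>D. \<forall>a\<in>D. le d a \<longrightarrow> P (f a))" for P
  proof
    assume "\<exists>p\<in>D'. \<forall>q\<in>D'. ?le p q \<longrightarrow> P (snd q)"
    then obtain d where d: "d \<in> D" "\<And>q. q \<in> D' \<Longrightarrow> fst q \<subseteq> T d \<Longrightarrow> P (snd q)"
      by (auto simp: D'_def)
    then show "\<exists>d\<in>D. \<forall>a\<in>D. le d a \<longrightarrow> P (f a)"
      using inD' by (intro bexI[of _ d] ballI impI) (use d(2)[OF inD'[OF d(1)]] in simp_all)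
  next
    assume "\<exists>d\<in>D. \<forall>a\<in>D. le d a \<longrightarrow> P (f a)"
    then obtain d where d: "d \<in> D" "\<And>a. a \<in> D \<Longrightarrow> le d a \<Longrightarrow> P (f a)" by auto
    have "P (snd q)" if "q \<in> D'" "fst q \<subseteq> T d" for q
      using that d by (force simp: D'_def T_def)
    then show "\<exists>p\<in>D'. \<forall>q\<in>D'. ?le p q \<longrightarrow> P (snd q)"
      using d(1) inD' refl by (intro bexI[of _ "(T d, f d)"]) auto
  qed
  have eq: "un_null F D' ?le snd \<longleftrightarrow> un_null F D le f" for F
    unfolding un_null_def tendsto_tails_iff[OF dir'] tendsto_tails_iff[OF dir]
    by (simp only: ev[of "\<lambda>h. \<bar>supnorm (\<lambda>t. min \<bar>h t\<bar> (g t)) - 0\<bar> < e" for g e])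
  have "\<forall>p\<in>D'. snd p \<in> J" using J by (auto simp: D'_def T_def)
  then show ?thesis
    using passes dir' null eq unfolding un_null_passes_def by blast
qed

end

theory Submission
  imports Defs
begin

text \<open>
  To an ideal \<open>J\<close> belongs the open set \<open>U\<close> of points at which some function of \<open>J\<close> does not
  vanish. Suppose that \<open>x \<notin> U\<close> is a limit point of \<open>U\<close>, and choose \<open>e \<ge> 0\<close> in \<open>C0 X\<close> with
  \<open>e x > 1/2\<close>. For every \<open>g \<ge> 0\<close> in \<open>J\<close> there is a point \<open>y \<in> U\<close> with \<open>g y < 1\<close> and
  \<open>e y > 1/2\<close>, and a function in \<open>J\<close> that is 1 at \<open>y\<close> and 0 where \<open>g \<ge> 1\<close>, namely a multiple of
  \<open>\<bar>h\<bar> * max 0 (1 - g)\<close> with \<open>h \<in> J\<close>, \<open>h y \<noteq> 0\<close>. The net of these functions, indexed by the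
  positive cone of \<open>J\<close>, is un-null in \<open>J\<close>, but \<open>e\<close> shows that it is not un-null in \<open>C0 X\<close>. So \<open>U\<close>
  is clopen. A closed ideal consists of all functions vanishing off \<open>U\<close>, and cutting functions off
  outside \<open>U\<close> is the band projection. For \<open>J = vanishing_ideal X {x}\<close>, which is a maximal ideal,
  \<open>U\<close> is the complement of \<open>x\<close>.
\<close>

section \<open>The space \<open>C0 X\<close>: membership criteria, bump functions and norm
  bounds\<close>

lemma C0_continuous: "f \<in> C0 X \<Longrightarrow> continuous_map X euclideanreal f"
  by (simp add: C0_def)

lemma C0_off_topspace: "f \<in> C0 X \<Longrightarrow> x \<notin> topspace X \<Longrightarrow> f x = 0"
  by (simp add: C0_def)

lemma C0_compactin_level: "f \<in> C0 X \<Longrightarrow> e > 0 \<Longrightarrow> compactin X {x \<in> topspace X. e \<le> \<bar>f x\<bar>}"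
  by (simp add: C0_def)

lemma closedin_level:
  assumes "continuous_map X euclideanreal f"
  shows "closedin X {x \<in> topspace X. e \<le> \<bar>f x\<bar>}"
proof -
  have "continuous_map X euclideanreal (\<lambda>x. \<bar>f x\<bar>)"
    using assms by (rule continuous_map_real_abs)
  from closedin_continuous_map_preimage[OF this, of "{e..}"] show ?thesis
    by simp
qed

text \<open>Where \<open>\<bar>f\<bar>\<close> reaches \<open>e\<close>, one of
  \<open>\<bar>g\<bar>\<close>, \<open>\<bar>h\<bar>\<close> reaches \<open>e / (2 * c)\<close>. So
  a level set of \<open>f\<close> is a closed subset of the union of two compact ones.\<close>

lemma C0_dominated:
  assumes f: "continuous_map X euclideanreal f" and g: "g \<in> C0 X" and h: "h \<in> C0 X" and c: "c > 0"
    and le: "\<And>x. \<bar>f x\<bar> \<le> c * (\<bar>g x\<bar> + \<bar>h x\<bar>)"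
  shows "f \<in> C0 X"
  unfolding C0_def
proof (intro CollectI conjI allI impI)
  show "continuous_map X euclideanreal f" by fact
  show "f x = 0" if "x \<notin> topspace X" for x
    using le[of x] C0_off_topspace[OF g that] C0_off_topspace[OF h that] by simp
  fix e :: real assume e: "e > 0"
  let ?d = "e / (2 * c)"
  have d: "?d > 0" using e c by simp
  have "{x \<in> topspace X. e \<le> \<bar>f x\<bar>} \<subseteq>
      {x \<in> topspace X. ?d \<le> \<bar>g x\<bar>} \<union> {x \<in> topspace X. ?d \<le> \<bar>h x\<bar>}"
  proof
    fix x assume x: "x \<in> {x \<in> topspace X. e \<le> \<bar>f x\<bar>}"
    then have "e \<le> c * (\<bar>g x\<bar> + \<bar>h x\<bar>)" using le[of x] by simp
    then have "e / c \<le> \<bar>g x\<bar> + \<bar>h x\<bar>" using c by (simp add: field_simps)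
    moreover have "e / c = ?d + ?d" by simp
    ultimately have "?d \<le> \<bar>g x\<bar> \<or> ?d \<le> \<bar>h x\<bar>" by linarith
    then show "x \<in> {x \<in> topspace X. ?d \<le> \<bar>g x\<bar>} \<union> {x \<in> topspace X. ?d \<le> \<bar>h x\<bar>}"
      using x by auto
  qed
  moreover have "compactin X ({x \<in> topspace X. ?d \<le> \<bar>g x\<bar>} \<union> {x \<in> topspace X. ?d \<le> \<bar>h x\<bar>})"
    by (intro compactin_Un C0_compactin_level g h d)
  ultimately show "compactin X {x \<in> topspace X. e \<le> \<bar>f x\<bar>}"
    using closed_compactin closedin_level[OF f] by blast
qed

lemma C0_zero: "(\<lambda>x. 0) \<in> C0 X"
  by (auto simp: C0_def)

lemma C0_dominated1:
  assumes "continuous_map X euclideanreal f" "g \<in> C0 X" "c > 0" "\<And>x. \<bar>f x\<bar> \<le> c * \<bar>g x\<bar>"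
  shows "f \<in> C0 X"
  using C0_dominated[OF assms(1,2) C0_zero assms(3)] assms(4) by simp

lemma C0_add: 
  assumes "f \<in> C0 X" "g \<in> C0 X"
  shows "(\<lambda>x. f x + g x) \<in> C0 X"
proof (rule C0_dominated[of _ _ f g 1])
  show "continuous_map X euclideanreal (\<lambda>x. f x + g x)"
    using assms by (intro continuous_map_add C0_continuous)
qed (use assms in auto)

lemma C0_cmult:
  assumes "f \<in> C0 X"
  shows "(\<lambda>x. c * f x) \<in> C0 X"
\<comment> \<open>Adding 1 keeps the factor positive when \<open>c = 0\<close>.\<close>
proof (rule C0_dominated1[of _ _ f "\<bar>c\<bar> + 1"])
  show "continuous_map X euclideanreal (\<lambda>x. c * f x)"
    using C0_continuous[OF assms] by (intro continuous_map_real_mult) simp_all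
qed (use assms in \<open>auto simp: abs_mult algebra_simps\<close>)

lemma C0_abs: 
  assumes "f \<in> C0 X"
  shows "(\<lambda>x. \<bar>f x\<bar>) \<in> C0 X"
proof (rule C0_dominated1[of _ _ f 1])
  show "continuous_map X euclideanreal (\<lambda>x. \<bar>f x\<bar>)"
    using assms by (intro continuous_map_real_abs C0_continuous)
qed (use assms in auto)

text \<open>Local compactness gives an open \<open>V\<close> around \<open>x\<close> inside a
  compact \<open>K\<close>, and complete regularity separates \<open>x\<close> from the complement
  of \<open>W \<inter> V\<close>. The resulting function vanishes outside \<open>K\<close>, hence at
  infinity.\<close>

lemma C0_bump:
  assumes "locally_compact_space X" and "Hausdorff_space X" and W: "openin X W" "x \<in> W"
  obtains e where "e \<in> C0 X" "e x = 1" "\<And>t. 0 \<le> e t" "\<And>t. t \<notin> W \<Longrightarrow> e t = 0"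
proof -
  have xX: "x \<in> topspace X" using W openin_subset by blast
  obtain V K where V: "openin X V" "compactin X K" "x \<in> V" "V \<subseteq> K"
    using assms(1) xX unfolding locally_compact_space_def by meson
  have "completely_regular_space X"
    using assms locally_compact_regular_imp_completely_regular_space
      locally_compact_Hausdorff_imp_regular_space by blast
  moreover have "closedin X (topspace X - (W \<inter> V))" "x \<in> topspace X - (topspace X - (W \<inter> V))"
    using W V xX by auto
  ultimately obtain f where f: "continuous_map X (top_of_set {0..1::real}) f" "f x = 0"
      "f ` (topspace X - (W \<inter> V)) \<subseteq> {1}"
    unfolding completely_regular_space_def by blast
  \<comment> \<open>The separating function is 0 at \<open>x\<close> and 1 on the closed set, so it
    is flipped; off \<open>topspace X\<close> the representation requires the value 0.\<close>
  define e where "e t = (if t \<in> topspace X then 1 - f t else 0)" for t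
  have f': "continuous_map X euclideanreal f" "\<And>t. t \<in> topspace X \<Longrightarrow> 0 \<le> f t \<and> f t \<le> 1"
    using f(1) by (auto simp: continuous_map_in_subtopology)
  have "continuous_map X euclideanreal (\<lambda>t. 1 - f t)"
    using f' by (intro continuous_map_diff) auto
  then have cont: "continuous_map X euclideanreal e"
    by (rule continuous_map_eq) (auto simp: e_def)
  have e0: "e t = 0" if "t \<notin> W \<inter> V" for t
    using f(3) that by (auto simp: e_def)
  have "{t \<in> topspace X. r \<le> \<bar>e t\<bar>} \<subseteq> K" if "r > 0" for r
    using e0 V that by force
  then have "e \<in> C0 X"
    unfolding C0_def using cont closed_compactin[OF V(2)] closedin_level[OF cont]
    by (auto simp: e_def)
  moreover have "e x = 1" "\<And>t. 0 \<le> e t" "\<And>t. t \<notin> W \<Longrightarrow> e t = 0"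
    using xX f f' e0 by (auto simp: e_def)
  ultimately show ?thesis using that by blast
qed

lemma supnorm_le: "(\<And>x. \<bar>f x\<bar> \<le> c) \<Longrightarrow> supnorm f \<le> c"
  unfolding supnorm_def by (rule cSUP_least) auto

text \<open>A real supremum bounds its family only when that family is bounded above. Here the bound
  of \<open>g\<close> serves, for arbitrary \<open>f\<close>.\<close>

lemma supnorm_min_ge:
  assumes "g \<in> C0 X" and g: "\<And>t. 0 \<le> g t"
  shows "min \<bar>f x\<bar> (g x) \<le> supnorm (\<lambda>t. min \<bar>f t\<bar> (g t))"
proof -
  have abs_eq: "\<bar>min \<bar>f t\<bar> (g t)\<bar> = min \<bar>f t\<bar> (g t)" for t
    using g[of t] by simp
  obtain B where "\<And>t. \<bar>g t\<bar> \<le> B"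
    using C0_bounded[OF assms(1)] by (auto simp: bdd_above_def)
  then have "min \<bar>f t\<bar> (g t) \<le> B" for t
    by (meson abs_le_D1 min.cobounded2 order_trans)
  then have "bdd_above (range (\<lambda>t. min \<bar>f t\<bar> (g t)))" by (intro bdd_aboveI2)
  then show ?thesis unfolding supnorm_def abs_eq by (intro cSUP_upper) auto
qed

section \<open>Order ideals and their cozero sets\<close>

lemma order_ideal_subset: "order_ideal E J \<Longrightarrow> f \<in> J \<Longrightarrow> f \<in> E"
  by (auto simp: order_ideal_def)

lemma order_ideal_zero: "order_ideal E J \<Longrightarrow> (\<lambda>t. 0) \<in> J"
  by (simp add: order_ideal_def)

lemma order_ideal_add: "order_ideal E J \<Longrightarrow> f \<in> J \<Longrightarrow> g \<in> J \<Longrightarrow> (\<lambda>t. f t + g t) \<in> J"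
  by (simp add: order_ideal_def)

lemma order_ideal_cmult: "order_ideal E J \<Longrightarrow> f \<in> J \<Longrightarrow> (\<lambda>t. c * f t) \<in> J"
  by (simp add: order_ideal_def)

lemma order_ideal_solid:
  "order_ideal E J \<Longrightarrow> f \<in> E \<Longrightarrow> g \<in> J \<Longrightarrow> (\<And>t. \<bar>f t\<bar> \<le> \<bar>g t\<bar>) \<Longrightarrow> f \<in> J"
  unfolding order_ideal_def by blast

lemma order_ideal_abs:
  assumes "order_ideal (C0 X) J" "f \<in> J"
  shows "(\<lambda>t. \<bar>f t\<bar>) \<in> J"
  by (rule order_ideal_solid[OF assms(1) C0_abs assms(2)])
     (use assms in \<open>auto intro: order_ideal_subset\<close>)

lemma order_ideal_sum:
  assumes "order_ideal E J" "finite S" "\<And>i. i \<in> S \<Longrightarrow> f i \<in> J"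
  shows "(\<lambda>t. \<Sum>i\<in>S. f i t) \<in> J"
  using assms(2,3)
  by (induction S rule: finite_induct)
     (auto intro: order_ideal_zero[OF assms(1)] order_ideal_add[OF assms(1)])

text \<open>The complement of the common zero set (hull) of \<open>J\<close>.\<close>

definition cozero_set :: "('a \<Rightarrow> real) set \<Rightarrow> 'a set" where
  "cozero_set J = {x. \<exists>f\<in>J. f x \<noteq> 0}"

lemma openin_cozero_set:
  assumes "J \<subseteq> C0 X"
  shows "openin X (cozero_set J)"
proof -
  have "openin X {x \<in> topspace X. f x \<in> - {0}}" if "f \<in> J" for f
    using assms that by (intro openin_continuous_map_preimage[of X euclideanreal] C0_continuous) auto
  moreover have "cozero_set J = (\<Union>f\<in>J. {x \<in> topspace X. f x \<in> - {0}})"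
    using assms C0_off_topspace by (fastforce simp: cozero_set_def)
  ultimately show ?thesis by auto
qed

section \<open>Closedness of the cozero set\<close>

lemma closedin_cozero_set:
  assumes X: "locally_compact_space X" "Hausdorff_space X"
    and J: "order_ideal (C0 X) J" and passes: "un_null_passes J (C0 X)"
  shows "closedin X (cozero_set J)"
proof (rule ccontr)
  let ?U = "cozero_set J"
  assume "\<not> closedin X ?U"
  moreover have "?U \<subseteq> topspace X"
    using J openin_cozero_set openin_subset unfolding order_ideal_def by blast
  ultimately obtain x where x: "x \<in> X closure_of ?U" "x \<notin> ?U"
    using closure_of_subset closure_of_eq by (metis subset_antisym subsetI)
  then have xX: "x \<in> topspace X" by (simp add: in_closure_of)
  obtain e where e: "e \<in> C0 X" "e x = 1" "\<And>t. 0 \<le> e t"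
    using C0_bump[OF X openin_topspace xX] by metis
  define D where "D = {g \<in> J. (\<lambda>t. 0) \<le> g}"
  let ?le = "(\<le>) :: ('a \<Rightarrow> real) \<Rightarrow> _ \<Rightarrow> bool"
  have ex: "\<exists>f\<in>J. (\<forall>t. g t \<ge> 1 \<longrightarrow> f t = 0) \<and> (\<exists>y. f y = 1 \<and> e y > 1/2)" if "g \<in> D" for g
  proof -
    have g: "g \<in> J" "\<And>t. 0 \<le> g t" using that by (auto simp: D_def le_fun_def)
    have gC: "g \<in> C0 X" using g J order_ideal_subset by blast
    define W where "W = {t \<in> topspace X. g t \<in> {..<1}} \<inter> {t \<in> topspace X. e t \<in> {1/2<..}}"
    have "openin X {t \<in> topspace X. g t \<in> {..<1}}" "openin X {t \<in> topspace X. e t \<in> {1/2<..}}"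
      by (intro openin_continuous_map_preimage[of X euclideanreal] C0_continuous gC e; simp)+
    then have "openin X W" unfolding W_def by (rule openin_Int)
    \<comment> \<open>Every member of \<open>J\<close> vanishes at \<open>x\<close>, so
      \<open>g x = 0 < 1\<close>. Thus \<open>W\<close> is a neighbourhood of \<open>x\<close> and
      meets \<open>?U\<close>.\<close>
    moreover have "x \<in> W"
      using x(2) g(1) e xX by (auto simp: cozero_set_def W_def)
    ultimately obtain y where "y \<in> ?U" "y \<in> W"
      using x(1) unfolding in_closure_of by meson
    then have y: "y \<in> ?U" "g y < 1" "e y > 1/2" by (auto simp: W_def)
    then obtain h where h: "h \<in> J" "h y \<noteq> 0" by (auto simp: cozero_set_def)
    have hC: "h \<in> C0 X" using h J order_ideal_subset by blast
    \<comment> \<open>Since \<open>g \<ge> 0\<close>, the second factor lies between 0 and 1, and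
      solidity puts \<open>k\<close> into \<open>J\<close>. It is nonzero at \<open>y\<close>
      because \<open>g y < 1\<close>.\<close>
    define k where "k t = \<bar>h t\<bar> * max 0 (1 - g t)" for t
    have k_le: "\<bar>k t\<bar> \<le> \<bar>h t\<bar>" for t
      using g(2)[of t] by (auto simp: k_def abs_mult intro!: mult_left_le)
    have "continuous_map X euclideanreal k"
      unfolding k_def
      using C0_continuous[OF hC] C0_continuous[OF gC]
      by (intro continuous_map_real_mult continuous_map_real_abs continuous_map_real_max
          continuous_map_diff) simp_all
    then have "k \<in> C0 X"
      using C0_dominated1[of X k h 1] hC k_le by simp
    then have "k \<in> J"
      using J h(1) k_le order_ideal_solid by blast
    then have "(\<lambda>t. (1 / k y) * k t) \<in> J"
      using J order_ideal_cmult by blast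
    moreover have "k y \<noteq> 0" using h y by (simp add: k_def)
    moreover have "k t = 0" if "g t \<ge> 1" for t using that by (simp add: k_def)
    ultimately show ?thesis
      using y(3) by (intro bexI[of _ "\<lambda>t. (1 / k y) * k t"]) auto
  qed
  then obtain F where F: "\<And>g. g \<in> D \<Longrightarrow> F g \<in> J" "\<And>g t. g \<in> D \<Longrightarrow> g t \<ge> 1 \<Longrightarrow> F g t = 0"
      "\<And>g. g \<in> D \<Longrightarrow> \<exists>y. F g y = 1 \<and> e y > 1/2"
    by metis
  have dir: "directed_on D ?le"
    unfolding directed_on_def
  proof (intro conjI ballI)
    show "D \<noteq> {}" using order_ideal_zero[OF J] by (auto simp: D_def)
    show "reflp_on D ?le" by (auto intro: reflp_onI)
    show "transp_on D ?le" by (auto intro: transp_onI)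
    fix a b assume "a \<in> D" "b \<in> D"
    then show "\<exists>c\<in>D. a \<le> c \<and> b \<le> c"
      using order_ideal_add[OF J, of a b]
      by (intro bexI[of _ "\<lambda>t. a t + b t"]) (auto simp: D_def le_fun_def)
  qed
  have "un_null J D ?le F"
    unfolding un_null_def tendsto_tails_iff[OF dir]
  proof (intro ballI impI allI)
    fix g and r :: real assume g: "g \<in> J" "(\<lambda>t. 0) \<le> g" and r: "r > 0"
    \<comment> \<open>For \<open>a \<ge> ?d\<close>, a point with \<open>a t < 1\<close> has
      \<open>g t \<le> r / 2\<close>, and a point with \<open>a t \<ge> 1\<close> has
      \<open>F a t = 0\<close>. Either way the minimum is at most \<open>r / 2\<close>.\<close>
    let ?d = "\<lambda>t. (2 / r) * g t"
    have "?d \<in> J" by (rule order_ideal_cmult[OF J g(1)])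
    then have "?d \<in> D" using g(2) r by (simp add: D_def le_fun_def)
    moreover have "\<bar>supnorm (\<lambda>t. min \<bar>F a t\<bar> (g t)) - 0\<bar> < r" if a: "a \<in> D" "?d \<le> a" for a
    proof -
      have g0: "0 \<le> g t" for t using g(2) by (auto simp: le_fun_def)
      have "\<bar>min \<bar>F a t\<bar> (g t)\<bar> \<le> r / 2" for t
      proof (cases "a t \<ge> 1")
        case True
        then show ?thesis using F(2)[OF a(1), of t] r g0[of t] by simp
      next
        case False
        moreover have "2 / r * g t \<le> a t" using a(2) by (auto simp: le_fun_def)
        ultimately have "2 / r * g t \<le> 1" by linarith
        then have "g t \<le> r / 2" using r by (simp add: field_simps)
        then show ?thesis using g0[of t] by linarith
      qed
      then have "supnorm (\<lambda>t. min \<bar>F a t\<bar> (g t)) \<le> r / 2" by (rule supnorm_le)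
      moreover have "0 \<le> supnorm (\<lambda>t. min \<bar>F a t\<bar> (g t))"
      proof -
        have "g \<in> C0 X" using g(1) J order_ideal_subset by blast
        \<comment> \<open>An arbitrary point suffices, as the value of the minimum there is a
          nonnegative lower bound for the norm.\<close>
        from supnorm_min_ge[OF this, of "F a" undefined] g0 show ?thesis
          by (meson abs_ge_zero min.boundedI order_trans)
      qed
      ultimately show ?thesis using r by linarith
    qed
    ultimately show "\<exists>d\<in>D. \<forall>a\<in>D. d \<le> a \<longrightarrow> \<bar>supnorm (\<lambda>t. min \<bar>F a t\<bar> (g t)) - 0\<bar> < r"
      by blast
  qed
  \<comment> \<open>The net is indexed by functions rather than by elements of
    \<open>'a index\<close>, hence the version for all index types.\<close>
  with un_null_passes_all_index_types[OF passes dir] F(1) have "un_null (C0 X) D ?le F"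
    by blast
  then have "((\<lambda>a. supnorm (\<lambda>t. min \<bar>F a t\<bar> (e t))) \<longlongrightarrow> 0) (tails D ?le)"
    using e(1,3) unfolding un_null_def by (simp add: le_fun_def)
  \<comment> \<open>The radius 1/2 matches the bound \<open>e y > 1/2\<close>: where
    \<open>F d y = 1\<close>, the minimum with \<open>e y\<close> exceeds 1/2. An index
    \<open>d\<close> belongs to its own tail, so \<open>F d\<close> itself gives the
    contradiction.\<close>
  then have "\<exists>d\<in>D. \<forall>a\<in>D. d \<le> a \<longrightarrow> \<bar>supnorm (\<lambda>t. min \<bar>F a t\<bar> (e t)) - 0\<bar> < 1/2"
    unfolding tendsto_tails_iff[OF dir] by (rule allE[of _ "1/2"]) simp
  then obtain d where d: "d \<in> D" "\<bar>supnorm (\<lambda>t. min \<bar>F d t\<bar> (e t)) - 0\<bar> < 1/2"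
    using order_refl by blast
  obtain y where "F d y = 1" "e y > 1/2" using F(3)[OF d(1)] by blast
  moreover have "min \<bar>F d y\<bar> (e y) \<le> supnorm (\<lambda>t. min \<bar>F d t\<bar> (e t))"
    using e(1,3) by (rule supnorm_min_ge)
  ultimately show False using d(2) by simp
qed

section \<open>Closed ideals and projection bands\<close>

lemma closed_ideal_eq_vanishing_ideal:
  assumes J: "order_ideal (C0 X) J" and closed: "norm_closed_in (C0 X) J"
  shows "J = vanishing_ideal X (- cozero_set J)"
proof
  show "J \<subseteq> vanishing_ideal X (- cozero_set J)"
    using J by (auto simp: vanishing_ideal_def cozero_set_def order_ideal_def)
  \<comment> \<open>By closedness it is enough to approximate \<open>f\<close> by members of
    \<open>J\<close>. Shrinking the values of \<open>f\<close> towards 0 by \<open>r / 2\<close>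
    yields a function that vanishes off a compact set \<open>?K\<close>; finitely many members of
    \<open>J\<close> dominate it on \<open>?K\<close>, so it lies in \<open>J\<close> by
    solidity.\<close>
  show "vanishing_ideal X (- cozero_set J) \<subseteq> J"
  proof
    fix f assume "f \<in> vanishing_ideal X (- cozero_set J)"
    then have f: "f \<in> C0 X" "\<And>t. f t \<noteq> 0 \<Longrightarrow> \<exists>h\<in>J. h t \<noteq> 0"
      by (auto simp: vanishing_ideal_def cozero_set_def)
    obtain B where B: "\<And>t. \<bar>f t\<bar> \<le> B"
      using C0_bounded[OF f(1)] by (auto simp: bdd_above_def)
    have B0: "B \<ge> 0" using B[of undefined] by linarith
    have "\<exists>g\<in>J. supnorm (\<lambda>t. f t - g t) < r" if r: "r > 0" for r
    proof -
      let ?e = "r / 2"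
      let ?K = "{t \<in> topspace X. ?e \<le> \<bar>f t\<bar>}"
      have "\<exists>h\<in>J. \<bar>h y\<bar> > B" if "y \<in> ?K" for y
      proof -
        have "f y \<noteq> 0" using that r by auto
        then obtain h where h: "h \<in> J" "h y \<noteq> 0" using f(2) by blast
        \<comment> \<open>The factor makes the value at \<open>y\<close> equal to
          \<open>B + 1\<close>, above the bound of \<open>f\<close>.\<close>
        then have "(\<lambda>t. ((B + 1) / h y) * h t) \<in> J" using J order_ideal_cmult by blast
        then show ?thesis using h(2) B0 by (intro bexI[of _ "\<lambda>t. ((B + 1) / h y) * h t"]) auto
      qed
      then obtain H where H: "\<And>y. y \<in> ?K \<Longrightarrow> H y \<in> J" "\<And>y. y \<in> ?K \<Longrightarrow> \<bar>H y y\<bar> > B"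
        by metis
      define V where "V y = {t \<in> topspace X. \<bar>H y t\<bar> \<in> {B<..}}" for y
      have V: "openin X (V y)" if "y \<in> ?K" for y
        unfolding V_def using H(1)[OF that] J
        by (intro openin_continuous_map_preimage[of X euclideanreal] continuous_map_real_abs
            C0_continuous) (auto intro: order_ideal_subset)
      have K: "compactin X ?K" using C0_compactin_level[OF f(1), of ?e] r by simp
      have "\<exists>F. finite F \<and> F \<subseteq> V ` ?K \<and> ?K \<subseteq> \<Union>F"
        using V H(2) by (intro compactinD[OF K]) (auto simp: V_def)
      then obtain F where F: "finite F" "F \<subseteq> V ` ?K" "?K \<subseteq> \<Union>F" by blast
      obtain S where S: "S \<subseteq> ?K" "finite S" "F = V ` S"
        using finite_subset_image[OF F(1,2)] by blast
      define h where "h t = (\<Sum>y\<in>S. \<bar>H y t\<bar>)" for t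
      have hJ: "h \<in> J"
        unfolding h_def using S H(1) by (auto intro!: order_ideal_sum[OF J] order_ideal_abs[OF J])
      have h_gt: "h t > B" if t: "t \<in> ?K" for t
      proof -
        obtain y where y: "y \<in> S" "t \<in> V y" using F(3) S(3) t by blast
        then have "B < \<bar>H y t\<bar>" by (simp add: V_def)
        also have "\<bar>H y t\<bar> \<le> h t"
          unfolding h_def using S(2) y(1) by (intro member_le_sum) auto
        finally show ?thesis .
      qed
      \<comment> \<open>The subtracted term is \<open>f\<close> clamped to the interval from
        \<open>- ?e\<close> to \<open>?e\<close>. So \<open>g\<close> is within \<open>?e\<close> of
        \<open>f\<close>, and it is 0 wherever \<open>\<bar>f t\<bar> < ?e\<close>.\<close>
      define g where "g t = f t - max (- ?e) (min ?e (f t))" for t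
      have "continuous_map X euclideanreal g"
        unfolding g_def
        using C0_continuous[OF f(1)]
        by (intro continuous_map_diff continuous_map_real_max continuous_map_real_min) simp_all
      then have "g \<in> C0 X"
        using C0_dominated1[of X g f 1] f(1) r by (auto simp: g_def max_def min_def)
      moreover have "\<bar>g t\<bar> \<le> \<bar>h t\<bar>" for t
      proof (cases "t \<in> ?K")
        case True
        have "\<bar>g t\<bar> \<le> \<bar>f t\<bar>" using r by (auto simp: g_def max_def min_def)
        then show ?thesis using B[of t] h_gt[OF True] by linarith
      next
        case False
        then have "\<bar>f t\<bar> < ?e" using C0_off_topspace[OF f(1), of t] r by auto
        then have "min ?e (f t) = f t" "max (- ?e) (f t) = f t" by linarith+
        then show ?thesis by (simp add: g_def)
      qed
      ultimately have "g \<in> J" using J hJ order_ideal_solid by blast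
      moreover have "supnorm (\<lambda>t. f t - g t) \<le> ?e"
        using r by (intro supnorm_le) (auto simp: g_def max_def min_def)
      ultimately show ?thesis using r by (intro bexI[of _ g]) auto
    qed
    then show "f \<in> J" using closed f(1) unfolding norm_closed_in_def by blast
  qed
qed

text \<open>A clopen set has empty frontier, so there is no point at which \<open>f\<close> and 0
  must agree for the glued function to be continuous.\<close>

lemma C0_restrict_clopen:
  assumes "f \<in> C0 X" "openin X U" "closedin X U"
  shows "(\<lambda>t. if t \<in> U then f t else 0) \<in> C0 X"
proof (rule C0_dominated1[of _ _ f 1])
  have "continuous_map X euclideanreal f" using assms by (simp add: C0_continuous)
  moreover have "X frontier_of U = {}"
    using assms(2,3) frontier_of_eq_empty[OF openin_subset[OF assms(2)]] by simp
  moreover have "{t \<in> topspace X. t \<in> U} = U"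
    using openin_subset[OF assms(2)] by blast
  ultimately show "continuous_map X euclideanreal (\<lambda>t. if t \<in> U then f t else 0)"
    by (intro continuous_map_cases continuous_map_from_subtopology) simp_all
qed (use assms in auto)

lemma projection_band_clopen:
  assumes J: "order_ideal (C0 X) J" and eq: "J = vanishing_ideal X (- U)"
    and U: "openin X U" "closedin X U"
  shows "projection_band (C0 X) J"
  unfolding projection_band_def
proof (intro conjI ballI)
  have in_J: "f \<in> J \<longleftrightarrow> f \<in> C0 X \<and> (\<forall>t. t \<notin> U \<longrightarrow> f t = 0)" for f
    by (auto simp: eq vanishing_ideal_def)
  show "band (C0 X) J"
    unfolding band_def
  proof (intro conjI allI impI)
    show "order_ideal (C0 X) J" by fact
    fix D :: "'a index set" and le u f
    assume *: "directed_on D le \<and> (\<forall>a\<in>D. u a \<in> J \<and> (\<lambda>t. 0) \<le> u a) \<and>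
        (\<forall>a\<in>D. \<forall>b\<in>D. le a b \<longrightarrow> u a \<le> u b) \<and> is_sup_in (C0 X) (u ` D) f"
    then have f: "f \<in> C0 X" "\<And>a. a \<in> D \<Longrightarrow> u a \<le> f"
        "\<And>h. h \<in> C0 X \<Longrightarrow> (\<And>a. a \<in> D \<Longrightarrow> u a \<le> h) \<Longrightarrow> f \<le> h"
      by (auto simp: is_sup_in_def)
    obtain a where a: "a \<in> D" using * by (auto simp: directed_on_def)
    have pos: "0 \<le> f t" for t
      using * a f(2)[OF a] by (auto simp: le_fun_def intro: order_trans)
    \<comment> \<open>Each \<open>u b\<close> vanishes off \<open>U\<close>, so the cut-off
      \<open>?h\<close> is still an upper bound. The least upper bound \<open>f\<close> lies below
      it, which together with \<open>f \<ge> 0\<close> forces \<open>f\<close> to vanish off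
      \<open>U\<close>.\<close>
    let ?h = "\<lambda>t. if t \<in> U then f t else 0"
    have "f \<le> ?h"
    proof (rule f(3))
      show "?h \<in> C0 X" using f(1) U by (rule C0_restrict_clopen)
      show "u b \<le> ?h" if "b \<in> D" for b
        using f(2)[OF that] * that by (auto simp: le_fun_def in_J)
    qed
    then have "f t = 0" if "t \<notin> U" for t
      using pos[of t] that by (auto simp: le_fun_def dest: spec[of _ t])
    then show "f \<in> J" using f(1) in_J by blast
  qed
  \<comment> \<open>Such an \<open>f\<close> is disjoint from itself.\<close>
  have "f = (\<lambda>t. 0)" if "f \<in> J \<inter> disjoint_complement (C0 X) J" for f
    using that unfolding disjoint_complement_def by fastforce
  moreover have "(\<lambda>t. 0) \<in> J \<inter> disjoint_complement (C0 X) J"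
    using in_J C0_zero[of X] by (simp add: disjoint_complement_def)
  ultimately show "J \<inter> disjoint_complement (C0 X) J = {\<lambda>t. 0}" by blast
  fix f assume f: "f \<in> C0 X"
  let ?g = "\<lambda>t. if t \<in> U then f t else 0"
  \<comment> \<open>The remainder is 0 on \<open>U\<close>, while members of \<open>J\<close> are 0
    off \<open>U\<close>.\<close>
  let ?h = "\<lambda>t. f t + (-1) * ?g t"
  have g: "?g \<in> C0 X" using f U by (rule C0_restrict_clopen)
  then have "?h \<in> C0 X" using C0_add[OF f C0_cmult] by blast
  then have "?h \<in> disjoint_complement (C0 X) J" by (auto simp: disjoint_complement_def in_J)
  moreover have "?g \<in> J" using g in_J by auto
  moreover have "f = (\<lambda>t. ?g t + ?h t)" by auto
  ultimately show "\<exists>g\<in>J. \<exists>h\<in>disjoint_complement (C0 X) J. f = (\<lambda>t. g t + h t)"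
    by (intro bexI[of _ ?g] bexI[of _ ?h])
qed

section \<open>Vanishing ideals, the maximal ideals of points, and isolated points\<close>

lemma order_ideal_vanishing_ideal: "order_ideal (C0 X) (vanishing_ideal X S)"
  unfolding order_ideal_def
proof (intro conjI ballI allI impI)
  let ?J = "vanishing_ideal X S"
  show "?J \<subseteq> C0 X" "(\<lambda>t. 0) \<in> ?J"
    by (auto simp: vanishing_ideal_def C0_zero)
  show "(\<lambda>t. f t + g t) \<in> ?J" if "f \<in> ?J" "g \<in> ?J" for f g
    using that by (simp add: vanishing_ideal_def C0_add)
  show "(\<lambda>t. c * f t) \<in> ?J" if "f \<in> ?J" for c f
    using that by (simp add: vanishing_ideal_def C0_cmult)
  show "f \<in> ?J" if "f \<in> C0 X" "g \<in> ?J" and le: "\<forall>t. \<bar>f t\<bar> \<le> \<bar>g t\<bar>" for f g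
  proof -
    have "f x = 0" if "x \<in> S" for x
      using le[rule_format, of x] \<open>g \<in> ?J\<close> that by (simp add: vanishing_ideal_def)
    then show ?thesis using \<open>f \<in> C0 X\<close> by (simp add: vanishing_ideal_def)
  qed
qed

text \<open>The ideal is the kernel of evaluation at \<open>x\<close>, a nonzero functional by
  \<open>C0_bump\<close>. It has codimension one, so together with any \<open>f\<close> satisfying
  \<open>f x \<noteq> 0\<close> it spans \<open>C0 X\<close>.\<close>

lemma maximal_ideal_vanishing_ideal:
  assumes X: "locally_compact_space X" "Hausdorff_space X" and x: "x \<in> topspace X"
  shows "maximal_ideal (C0 X) (vanishing_ideal X {x})"
  unfolding maximal_ideal_def
proof (intro conjI allI impI order_ideal_vanishing_ideal)
  let ?J = "vanishing_ideal X {x}"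
  obtain e where e: "e \<in> C0 X" "e x = 1"
    using C0_bump[OF X openin_topspace x] by metis
  then have "e \<notin> ?J" by (simp add: vanishing_ideal_def)
  then show "?J \<noteq> C0 X" using e(1) by blast
  fix I assume I: "order_ideal (C0 X) I \<and> ?J \<subseteq> I"
  show "I = ?J \<or> I = C0 X"
  proof (cases "I = ?J")
    case False
    then obtain f where f: "f \<in> I" "f x \<noteq> 0" "f \<in> C0 X"
      using I by (auto simp: vanishing_ideal_def order_ideal_def)
    have "g \<in> I" if g: "g \<in> C0 X" for g
    proof -
      let ?c = "g x / f x"
      have "(\<lambda>t. g t + (- ?c) * f t) \<in> ?J"
        using f C0_add[OF g C0_cmult[OF f(3), of "- ?c"]] by (simp add: vanishing_ideal_def)
      then have "(\<lambda>t. (g t + (- ?c) * f t) + ?c * f t) \<in> I"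
        using I order_ideal_add order_ideal_cmult[OF _ f(1), of "C0 X" ?c] by blast
      then show ?thesis by simp
    qed
    then show ?thesis using I order_ideal_subset by blast
  qed simp
qed

text \<open>Points are closed, so a bump at \<open>y \<noteq> x\<close> can be supported away from
  \<open>x\<close>.\<close>

lemma cozero_set_vanishing_ideal_point:
  assumes X: "locally_compact_space X" "Hausdorff_space X"
  shows "cozero_set (vanishing_ideal X {x}) = topspace X - {x}"
proof
  show "cozero_set (vanishing_ideal X {x}) \<subseteq> topspace X - {x}"
    using C0_off_topspace by (force simp: cozero_set_def vanishing_ideal_def)
  show "topspace X - {x} \<subseteq> cozero_set (vanishing_ideal X {x})"
  proof
    fix y assume y: "y \<in> topspace X - {x}"
    have "openin X (topspace X - {x})"
      using X(2) by (metis Hausdorff_imp_t1_space t1_space_openin_delete_alt openin_topspace)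
    then obtain e where "e \<in> C0 X" "e y = 1" "e x = 0"
      using C0_bump[OF X _ y] by (metis Diff_iff singletonI)
    then show "y \<in> cozero_set (vanishing_ideal X {x})"
      by (auto simp: cozero_set_def vanishing_ideal_def intro!: bexI[of _ e])
  qed
qed

lemma isolated_if_un_null_passes:
  assumes X: "locally_compact_space X" "Hausdorff_space X" and x: "x \<in> topspace X"
    and "un_null_passes (vanishing_ideal X {x}) (C0 X)"
  shows "openin X {x}"
proof -
  have "closedin X (topspace X - {x})"
    using closedin_cozero_set[OF X order_ideal_vanishing_ideal assms(4)]
      cozero_set_vanishing_ideal_point[OF X] by simp
  then show ?thesis using x by (simp add: openin_closedin)
qed

theorem theorem7p5:
  fixes X :: "'a topology"
  assumes "locally_compact_space X" and "Hausdorff_space X"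
  shows "(\<forall>J. order_ideal (C0 X) J \<and> norm_closed_in (C0 X) J \<and> un_null_passes J (C0 X)
              \<longrightarrow> projection_band (C0 X) J) \<and>
         (\<forall>x\<in>topspace X. un_null_passes (vanishing_ideal X {x}) (C0 X) \<longrightarrow> openin X {x}) \<and>
         ((\<forall>J. maximal_ideal (C0 X) J \<longrightarrow> un_null_passes J (C0 X))
              \<longrightarrow> X = discrete_topology (topspace X))"
proof (intro conjI allI ballI impI)
  fix J assume J: "order_ideal (C0 X) J \<and> norm_closed_in (C0 X) J \<and> un_null_passes J (C0 X)"
  then have "openin X (cozero_set J)"
    using openin_cozero_set unfolding order_ideal_def by blast
  moreover have "closedin X (cozero_set J)" "J = vanishing_ideal X (- cozero_set J)"
    using J closedin_cozero_set[OF assms] closed_ideal_eq_vanishing_ideal by blast+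
  ultimately show "projection_band (C0 X) J"
    using J projection_band_clopen by blast
next
  fix x assume "x \<in> topspace X" "un_null_passes (vanishing_ideal X {x}) (C0 X)"
  then show "openin X {x}" by (rule isolated_if_un_null_passes[OF assms])
next
  assume "\<forall>J. maximal_ideal (C0 X) J \<longrightarrow> un_null_passes J (C0 X)"
  \<comment> \<open>The hypothesis is applied to the maximal ideals
    \<open>vanishing_ideal X {x}\<close>, one for each point.\<close>
  then have "openin X {x}" if "x \<in> topspace X" for x
    using maximal_ideal_vanishing_ideal[OF assms that] isolated_if_un_null_passes[OF assms that]
    by blast
  then show "X = discrete_topology (topspace X)"
    by (metis discrete_topology_unique)
qed

end
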